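(* Let $\mathcal{A}$ be a $C^*$-algebra with unit $e$. For $a\in\mathcal{A}$ the following conditions are mutually equivalent: (i) $a\perp_R e$, i.e. $\|a+\lambda e\|=\|a-\lambda e\|$ for all $\lambda\in\mathbb{C}$; (ii) $DV_{ub}(a)=DV_{ub}(-a)$.
   Context: $C^*$-algebras are complex. For elements $x,y$ of a complex normed linear space, $x$ is Roberts orthogonal to $y$, written $x\perp_R y$, if $\|x+\lambda y\|=\|x-\lambda y\|$ for all $\lambda\in\mathbb{C}$. $S(\mathcal{A})$ denotes the set of states of $\mathcal{A}$, i.e. positive linear functionals on $\mathcal{A}$ of norm $1$. For $b\in\mathcal{A}$ the Davis--Wielandt shell of $b$ is $DV(b)=\{(\varphi(b),\varphi(b^*b)):\varphi\in S(\mathcal{A})\}\subseteq\mathbb{C}\times\mathbb{R}$. For $\mu\in\mathbb{C}$ let $\mathcal{L}_\mu(b)=\{\varphi(b^*b):\varphi\in S(\mathcal{A}),\ \varphi(b)=\mu\}$, which is a compact subset of $\mathbb{R}$. The upper boundary of $DV(b)$ is $DV_{ub}(b)=\{(\mu,r)\in DV(b): r=\max\mathcal{L}_\mu(b)\}$. *)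

theory Defs
  imports "HOL-Analysis.Analysis"
begin

text \<open>Complex normed spaces extend the real ones: the real scaling is the restriction of the
  complex scaling, so the real library remains applicable.\<close>

class scaleC =
  fixes scaleC :: "complex \<Rightarrow> 'a \<Rightarrow> 'a" (infixr \<open>*\<^sub>C\<close> 75)

class complex_normed_vector = real_normed_vector + scaleC +
  assumes scaleC_add_right: "c *\<^sub>C (x + y) = c *\<^sub>C x + c *\<^sub>C y"
    and scaleC_add_left: "(c + d) *\<^sub>C x = c *\<^sub>C x + d *\<^sub>C x"
    and scaleC_scaleC: "c *\<^sub>C d *\<^sub>C x = (c * d) *\<^sub>C x"
    and scaleC_of_real: "complex_of_real r *\<^sub>C x = r *\<^sub>R x"
    and norm_scaleC: "norm (c *\<^sub>C x) = cmod c * norm x"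

text \<open>Unital complex $C^*$-algebras. The unit is \<open>1\<close>; as usual for unital normed algebras,
  \<open>real_normed_algebra_1\<close> includes \<open>norm 1 = 1\<close>, i.e. the algebra is nonzero.\<close>

class unital_cstar_algebra = complex_normed_vector + real_normed_algebra_1 + banach +
  fixes star :: "'a \<Rightarrow> 'a"
  assumes scaleC_mult_left: "(c *\<^sub>C x) * y = c *\<^sub>C (x * y)"
    and scaleC_mult_right: "x * (c *\<^sub>C y) = c *\<^sub>C (x * y)"
    and star_add: "star (x + y) = star x + star y"
    and star_scaleC: "star (c *\<^sub>C x) = cnj c *\<^sub>C star x"
    and star_mult: "star (x * y) = star y * star x"
    and star_star: "star (star x) = x"
    and cstar_identity: "norm (star x * x) = (norm x)\<^sup>2"

instantiation complex :: unital_cstar_algebra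
begin

definition scaleC_complex :: "complex \<Rightarrow> complex \<Rightarrow> complex"
  where "scaleC_complex = (*)"

definition star_complex :: "complex \<Rightarrow> complex"
  where "star_complex = cnj"

instance
  by standard (auto simp: scaleC_complex_def star_complex_def algebra_simps norm_mult
      scaleR_conv_of_real power2_eq_square)

end

definition roberts_orthogonal :: "'a::complex_normed_vector \<Rightarrow> 'a \<Rightarrow> bool" (infix \<open>\<bottom>\<^sub>R\<close> 50)
  where "x \<bottom>\<^sub>R y \<longleftrightarrow> (\<forall>c::complex. norm (x + c *\<^sub>C y) = norm (x - c *\<^sub>C y))"

text \<open>The positive elements of a $C^*$-algebra are the elements \<open>star x * x\<close>. The functional norm
  is \<open>onorm\<close>, which is the operator norm only for bounded functionals.\<close>

definition states :: "('a::unital_cstar_algebra \<Rightarrow> complex) set"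
  where "states = {\<phi>. bounded_linear \<phi> \<and> (\<forall>c x. \<phi> (c *\<^sub>C x) = c * \<phi> x) \<and>
    (\<forall>x. \<phi> (star x * x) \<in> \<real>\<^sub>\<ge>\<^sub>0) \<and> onorm \<phi> = 1}"

text \<open>For a state, \<open>\<phi> (star b * b)\<close> is a nonnegative real, so \<open>Re\<close> only changes its type.\<close>

definition DV :: "'a::unital_cstar_algebra \<Rightarrow> (complex \<times> real) set"
  where "DV b = {(\<phi> b, Re (\<phi> (star b * b))) | \<phi>. \<phi> \<in> states}"

definition DV_fibre :: "complex \<Rightarrow> 'a::unital_cstar_algebra \<Rightarrow> real set"
  where "DV_fibre \<mu> b = {Re (\<phi> (star b * b)) | \<phi>. \<phi> \<in> states \<and> \<phi> b = \<mu>}"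

text \<open>The maximum is spelled out because \<open>Max\<close> is meaningful for finite sets only.\<close>

definition DV_ub :: "'a::unital_cstar_algebra \<Rightarrow> (complex \<times> real) set"
  where "DV_ub b = {(\<mu>, r). (\<mu>, r) \<in> DV b \<and> r \<in> DV_fibre \<mu> b \<and> (\<forall>s\<in>DV_fibre \<mu> b. s \<le> r)}"

end

theory Submission
  imports Defs
begin

text \<open>
  For a state \<open>\<phi>\<close> and a scalar \<open>c\<close>,
  \<open>\<phi> (star (b + c) * (b + c)) = \<phi> (star b * b) + 2 * Re (cnj c * \<phi> b) + \<bar>c\<bar>\<^sup>2\<close>, and the maximum of the
  left side over all states is \<open>\<parallel>b + c\<parallel>\<^sup>2\<close>. Thus \<open>\<parallel>b + c\<parallel>\<^sup>2 - \<bar>c\<bar>\<^sup>2\<close> is the support function of the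
  Davis--Wielandt shell in the upward direction \<open>(2 * c, 1)\<close>. The shell is compact and convex, because
  the state space is weak-* compact and convex, and the upward directions of a compact convex set
  determine exactly its upper boundary, by separation. So \<open>DV_ub a = DV_ub b\<close> holds iff
  \<open>\<parallel>a + c\<parallel> = \<parallel>b + c\<parallel>\<close> for all \<open>c\<close> (\<open>DV_ub_eq_iff_norm_shift_eq\<close>), and the theorem is the case
  \<open>b = - a\<close>, where \<open>\<parallel>- a + c\<parallel> = \<parallel>a - c\<parallel>\<close>.

  The analytic input is that states attain the norm (\<open>state_attaining_norm\<close>). By the Hahn--Banach
  theorem a real functional supports the unit ball in the direction of \<open>1 + star x * x\<close>. That it is positive,
  and that it detects the norm of \<open>star x * x\<close>, rests on Kaplansky's theorem that \<open>star x * x\<close> lies in the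
  positive cone (\<open>positive_star_mult\<close>). The proof given for it uses no spectra: positivity is
  expressed by norms, square roots come from a power series that converges on the closed unit disc, and
  the comparison of the spectra of \<open>x * star x\<close> and \<open>star x * x\<close> is replaced by a growth estimate
  for powers (\<open>eq_zero_if_opposite_signs\<close>).
\<close>

section \<open>Scalars and the involution\<close>

lemma scaleR_eq_scaleC: "r *\<^sub>R x = complex_of_real r *\<^sub>C (x::'a::complex_normed_vector)"
  by (simp add: scaleC_of_real)

lemma scaleC_one [simp]: "1 *\<^sub>C (x::'a::complex_normed_vector) = x"
  using scaleC_of_real[of 1 x] by simp

lemma scaleC_minus_one: "(-1) *\<^sub>C (x::'a::complex_normed_vector) = - x"
  using scaleC_of_real[of "-1" x] by simp

lemma scaleC_zero_right [simp]: "c *\<^sub>C (0::'a::complex_normed_vector) = 0"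
  using scaleC_add_right[of c 0 "0::'a"] by simp

lemma scaleC_minus_right: "c *\<^sub>C (- x) = - (c *\<^sub>C (x::'a::complex_normed_vector))"
  using scaleC_add_right[of c x "- x"] by (simp add: eq_neg_iff_add_eq_0 add.commute)

lemma scaleC_minus_left: "(- c) *\<^sub>C x = - (c *\<^sub>C (x::'a::complex_normed_vector))"
  using scaleC_scaleC[of "-1" c x] by (simp add: scaleC_minus_one)

lemma scaleC_diff_right: "c *\<^sub>C (x - y) = c *\<^sub>C x - c *\<^sub>C (y::'a::complex_normed_vector)"
  using scaleC_add_right[of c x "- y"] by (simp add: scaleC_minus_right)

lemma star_zero [simp]: "star (0::'a::unital_cstar_algebra) = 0"
  using star_add[of 0 "0::'a"] by simp

lemma star_minus: "star (- x) = - star (x::'a::unital_cstar_algebra)"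
  using star_add[of x "- x"] by (simp add: eq_neg_iff_add_eq_0 add.commute)

lemma star_diff: "star (x - y) = star x - star (y::'a::unital_cstar_algebra)"
  using star_add[of x "- y"] by (simp add: star_minus)

lemma star_scaleR: "star (r *\<^sub>R x) = r *\<^sub>R star (x::'a::unital_cstar_algebra)"
  by (simp add: scaleR_eq_scaleC star_scaleC)

lemma star_one [simp]: "star (1::'a::unital_cstar_algebra) = 1"
  by (metis mult_1_left mult_1_right star_mult star_star)

lemma star_power: "star (x ^ n) = star (x::'a::unital_cstar_algebra) ^ n"
  by (induction n) (simp_all add: star_mult power_commutes)

lemma norm_star [simp]: "norm (star x) = norm (x::'a::unital_cstar_algebra)"
proof -
  have le: "norm y \<le> norm (star y)" for y :: 'a
  proof (cases "y = 0")
    case False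
    have "norm y * norm y \<le> norm (star y) * norm y"
      using norm_mult_ineq[of "star y" y] by (simp add: cstar_identity power2_eq_square)
    with False show ?thesis by simp
  qed simp
  show ?thesis using le[of x] le[of "star x"] by (simp add: star_star)
qed

lemma bounded_linear_star: "bounded_linear (star :: 'a::unital_cstar_algebra \<Rightarrow> 'a)"
  by (rule bounded_linear_intro[where K = 1]) (simp_all add: star_add star_scaleR)

lemma star_mult_self_eq_0: "star x * x = 0 \<longleftrightarrow> x = (0::'a::unital_cstar_algebra)"
  by (metis cstar_identity norm_eq_zero mult_zero_right power_eq_0_iff norm_zero)

lemma norm_square_selfadjoint:
  "star x = x \<Longrightarrow> norm (x * x) = (norm x)\<^sup>2" for x :: "'a::unital_cstar_algebra"
  using cstar_identity[of x] by simp

section \<open>Square roots by a power series\<close>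

text \<open>The Taylor coefficients of \<open>sqrt (1 - z)\<close>.\<close>

definition sqrt_coeff :: "nat \<Rightarrow> real"
  where "sqrt_coeff n = (-1) ^ n * (1/2 gchoose n)"

lemma sqrt_coeff_0 [simp]: "sqrt_coeff 0 = 1"
  by (simp add: sqrt_coeff_def)

lemma sqrt_coeff_Suc_nonpos: "sqrt_coeff (Suc n) \<le> 0"
proof -
  have "sqrt_coeff (Suc n) = pochhammer (- (1/2)) (Suc n) / fact (Suc n)"
    by (simp add: sqrt_coeff_def gbinomial_pochhammer flip: power_mult_distrib)
  also have "\<dots> = - (1/2) * pochhammer (1/2) n / fact (Suc n)"
    by (simp add: pochhammer_rec)
  also have "\<dots> \<le> 0"
    by (simp add: pochhammer_nonneg)
  finally show ?thesis .
qed

text \<open>All coefficients but the first are nonpositive and every partial sum is nonnegative, so the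
  others have absolute sum at most 1. The series therefore converges on the closed unit disc.\<close>

lemma sqrt_coeff_partial_sum: "(\<Sum>k<n. \<bar>sqrt_coeff (Suc k)\<bar>) \<le> 1"
proof -
  have "(\<Sum>k\<le>n. sqrt_coeff k) = (-1) ^ n * (- (1/2) gchoose n)"
    using gbinomial_sum_lower_neg[of "1/2::real" n] by (simp add: sqrt_coeff_def mult.commute)
  also have "\<dots> = pochhammer (1/2) n / fact n"
    by (simp add: gbinomial_pochhammer flip: power_mult_distrib)
  also have "\<dots> \<ge> 0"
    by (simp add: pochhammer_nonneg)
  finally have "0 \<le> 1 + (\<Sum>k<n. sqrt_coeff (Suc k))"
    by (simp add: sum.atMost_shift)
  then show ?thesis
    by (simp add: sqrt_coeff_Suc_nonpos abs_of_nonpos sum_negf)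
qed

lemma summable_abs_sqrt_coeff: "summable (\<lambda>n. \<bar>sqrt_coeff (Suc n)\<bar>)"
  by (rule summableI_nonneg_bounded[OF _ sqrt_coeff_partial_sum]) simp

lemma sqrt_coeff_convolution:
  "(\<Sum>i\<le>n. sqrt_coeff i * sqrt_coeff (n - i)) = (if n = 0 then 1 else if n = 1 then -1 else 0)"
proof -
  have "(\<Sum>i\<le>n. sqrt_coeff i * sqrt_coeff (n - i))
      = (\<Sum>i\<le>n. (-1) ^ n * ((1/2 gchoose i) * (1/2 gchoose (n - i))))"
  proof (rule sum.cong[OF refl])
    fix i assume "i \<in> {..n}"
    then have "(-1 :: real) ^ n = (-1) ^ i * (-1) ^ (n - i)"
      by (simp flip: power_add)
    then show "sqrt_coeff i * sqrt_coeff (n - i)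
        = (-1) ^ n * ((1/2 gchoose i) * (1/2 gchoose (n - i)))"
      by (simp add: sqrt_coeff_def)
  qed
  also have "\<dots> = (-1) ^ n * (1 gchoose n)"
    using gbinomial_Vandermonde[of "1/2::real" "1/2" n]
    by (simp add: sum_distrib_left[symmetric] atLeast0AtMost)
  also have "\<dots> = (-1) ^ n * of_nat (1 choose n)"
    using binomial_gbinomial[of 1 n, where ?'a = real] by simp
  also have "\<dots> = (if n = 0 then 1 else if n = 1 then -1 else 0)"
    by (auto simp: binomial_eq_0)
  finally show ?thesis .
qed

text \<open>Besides squaring to \<open>1 - z\<close>, the root has to commute with everything that commutes with
  \<open>z\<close>, since this replaces the functional calculus, and to lie in the unit ball around \<open>1\<close>, which
  makes it positive.\<close>

lemma sqrt_one_minus: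
  fixes z :: "'a::unital_cstar_algebra"
  assumes sa: "star z = z" and z1: "norm z \<le> 1"
  obtains s where "star s = s" "s * s = 1 - z" "norm (1 - s) \<le> 1"
    "\<And>b. b * z = z * b \<Longrightarrow> b * s = s * b"
proof -
  define f where "f n = sqrt_coeff n *\<^sub>R z ^ n" for n
  define s where "s = (\<Sum>n. f n)"
  have le: "norm (f n) \<le> \<bar>sqrt_coeff n\<bar>" for n
  proof -
    have "norm (z ^ n) \<le> norm z ^ n"
      by (rule norm_power_ineq)
    also have "\<dots> \<le> 1"
      using z1 by (simp add: power_le_one)
    finally show ?thesis
      by (simp add: f_def mult_left_le)
  qed
  have tail: "summable (\<lambda>n. norm (f (Suc n)))"
    by (rule summable_comparison_test'[OF summable_abs_sqrt_coeff]) (simp add: le)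
  then have sn: "summable (\<lambda>n. norm (f n))"
    by (simp only: summable_Suc_iff[where f = "\<lambda>n. norm (f n)"])
  then have sf: "summable f"
    by (rule summable_norm_cancel)
  have "star s = (\<Sum>n. star (f n))"
    unfolding s_def by (rule bounded_linear.suminf[OF bounded_linear_star sf])
  also have "\<dots> = s"
    by (simp add: f_def s_def star_scaleR star_power sa)
  finally have 1: "star s = s" .
  have "(\<Sum>i\<le>n. f i * f (n - i)) = (\<Sum>i\<le>n. sqrt_coeff i * sqrt_coeff (n - i)) *\<^sub>R z ^ n" for n
    unfolding scaleR_sum_left
  proof (rule sum.cong[OF refl])
    fix i assume "i \<in> {..n}"
    then have "z ^ n = z ^ i * z ^ (n - i)"
      by (simp flip: power_add)
    then show "f i * f (n - i) = (sqrt_coeff i * sqrt_coeff (n - i)) *\<^sub>R z ^ n"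
      by (simp add: f_def)
  qed
  then have conv: "(\<Sum>i\<le>n. f i * f (n - i)) = (if n = 0 then 1 else if n = 1 then - z else 0)" for n
    by (simp add: sqrt_coeff_convolution)
  have "(\<lambda>n. if n = 0 then 1 else if n = 1 then - z else 0) sums (s * s)"
    using Cauchy_product_sums[OF sn sn] unfolding conv s_def .
  moreover have "(\<lambda>n. if n = 0 then 1 else if n = 1 then - z else 0) sums
      (\<Sum>n\<in>{0, 1::nat}. if n = 0 then 1 else if n = 1 then - z else (0::'a))"
    by (rule sums_finite) auto
  ultimately have 2: "s * s = 1 - z"
    using sums_unique2 by fastforce
  have "s = f 0 + (\<Sum>n. f (Suc n))"
    unfolding s_def by (simp add: suminf_split_head[OF sf])
  then have "norm (1 - s) = norm (\<Sum>n. f (Suc n))"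
    by (simp add: f_def)
  also have "\<dots> \<le> (\<Sum>n. \<bar>sqrt_coeff (Suc n)\<bar>)"
    by (rule norm_suminf_le[OF le summable_abs_sqrt_coeff])
  also have "\<dots> \<le> 1"
    by (rule suminf_le_const[OF summable_abs_sqrt_coeff sqrt_coeff_partial_sum])
  finally have 3: "norm (1 - s) \<le> 1" .
  have 4: "b * s = s * b" if "b * z = z * b" for b
  proof -
    have "b * z ^ n = z ^ n * b" for n
      using that by (induction n) (simp_all add: mult.assoc, metis mult.assoc)
    then have "b * f n = f n * b" for n
      by (simp add: f_def)
    then show ?thesis
      by (simp add: s_def suminf_mult[OF sf, symmetric] suminf_mult2[OF sf])
  qed
  show thesis by (rule that[OF 1 2 3 4])
qed

section \<open>The positive cone\<close>

text \<open>Positivity is expressed by the norm alone: the spectrum of a selfadjoint \<open>h\<close> is nonnegative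
  iff a ball centred at a point \<open>t \<ge> 0\<close> and reaching down to \<open>0\<close> contains \<open>h\<close>. Closure
  under sums is then the triangle inequality.\<close>

definition cstar_positive :: "'a::unital_cstar_algebra \<Rightarrow> bool"
  where "cstar_positive h \<longleftrightarrow> star h = h \<and> (\<exists>t\<ge>0. norm (t *\<^sub>R 1 - h) \<le> t)"

lemma positive_add: "cstar_positive h \<Longrightarrow> cstar_positive k \<Longrightarrow> cstar_positive (h + k)"
proof -
  assume "cstar_positive h" "cstar_positive k"
  then obtain s t where st: "s \<ge> 0" "norm (s *\<^sub>R 1 - h) \<le> s" "t \<ge> 0" "norm (t *\<^sub>R 1 - k) \<le> t"
    and sa: "star h = h" "star k = k"
    unfolding cstar_positive_def by blast
  have "(s + t) *\<^sub>R 1 - (h + k) = (s *\<^sub>R 1 - h) + (t *\<^sub>R 1 - k)"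
    by (simp add: scaleR_add_left)
  then have "norm ((s + t) *\<^sub>R 1 - (h + k)) \<le> norm (s *\<^sub>R 1 - h) + norm (t *\<^sub>R 1 - k)"
    by (simp only: norm_triangle_ineq)
  also have "\<dots> \<le> s + t"
    using st by simp
  finally have "norm ((s + t) *\<^sub>R 1 - (h + k)) \<le> s + t" .
  with st sa show ?thesis
    unfolding cstar_positive_def by (auto simp: star_add intro!: exI[of _ "s + t"])
qed

lemma positive_scaleR:
  assumes "cstar_positive h" "r \<ge> 0"
  shows "cstar_positive (r *\<^sub>R h)"
proof -
  obtain t where t: "t \<ge> 0" "norm (t *\<^sub>R 1 - h) \<le> t" and sa: "star h = h"
    using assms(1) unfolding cstar_positive_def by blast
  have "(r * t) *\<^sub>R 1 - r *\<^sub>R h = r *\<^sub>R (t *\<^sub>R 1 - h)"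
    by (simp add: scaleR_diff_right)
  then have "norm ((r * t) *\<^sub>R 1 - r *\<^sub>R h) \<le> r * t"
    using t assms(2) by (simp add: mult_left_mono)
  with t sa assms(2) show ?thesis
    unfolding cstar_positive_def by (auto simp: star_scaleR intro!: exI[of _ "r * t"])
qed

lemma positive_one: "cstar_positive 1"
  unfolding cstar_positive_def by (auto intro!: exI[of _ 1])

lemma positive_sqrt:
  assumes "cstar_positive h"
  obtains s where "cstar_positive s" "s * s = h" "\<And>b. b * h = h * b \<Longrightarrow> b * s = s * b"
proof -
  obtain t where t: "t \<ge> 0" "norm (t *\<^sub>R 1 - h) \<le> t" and sa: "star h = h"
    using assms unfolding cstar_positive_def by blast
  show thesis
  proof (cases "t = 0")
    case True
    with t have "h = 0" by simp
    moreover have "cstar_positive (0::'a)"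
      unfolding cstar_positive_def by (auto intro!: exI[of _ 0])
    ultimately show thesis by (intro that[of 0]) auto
  next
    case False
    with t have t0: "t > 0" by simp
    define z where "z = (1/t) *\<^sub>R (t *\<^sub>R 1 - h)"
    have z: "z = 1 - (1/t) *\<^sub>R h"
      using t0 by (simp add: z_def scaleR_diff_right)
    have "star z = z"
      by (simp add: z star_diff star_scaleR sa)
    moreover have "norm z \<le> 1"
      using t t0 by (simp add: z_def)
    ultimately obtain s where s: "star s = s" "s * s = 1 - z" "norm (1 - s) \<le> 1"
      and comm: "\<And>b. b * z = z * b \<Longrightarrow> b * s = s * b"
      using sqrt_one_minus by metis
    have "cstar_positive s"
      using s unfolding cstar_positive_def by (auto intro!: exI[of _ 1])
    show thesis
    proof (rule that[of "sqrt t *\<^sub>R s"])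
      show "cstar_positive (sqrt t *\<^sub>R s)"
        using \<open>cstar_positive s\<close> t0 by (simp add: positive_scaleR)
      show "(sqrt t *\<^sub>R s) * (sqrt t *\<^sub>R s) = h"
        using t0 by (simp add: s z)
      fix b assume "b * h = h * b"
      then have "b * z = z * b"
        by (simp add: z algebra_simps)
      then show "b * (sqrt t *\<^sub>R s) = (sqrt t *\<^sub>R s) * b"
        by (simp add: comm)
    qed
  qed
qed

text \<open>The commuting selfadjoint pair is treated as a normal element \<open>u = \<alpha> + \<i>\<beta>\<close>, whose norm is known
  exactly because \<open>star u * u = \<alpha>\<^sup>2 + \<beta>\<^sup>2\<close>. Both \<open>\<alpha>\<close> and \<open>\<alpha>\<^sup>2 - \<beta>\<^sup>2\<close> are real parts, of \<open>u\<close> and of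
  \<open>u\<^sup>2\<close>.\<close>

lemma commuting_selfadjoint_norms:
  fixes \<alpha> \<beta> :: "'a::unital_cstar_algebra"
  assumes sa: "star \<alpha> = \<alpha>" "star \<beta> = \<beta>" and comm: "\<alpha> * \<beta> = \<beta> * \<alpha>"
  shows "(norm \<alpha>)\<^sup>2 \<le> norm (\<alpha> * \<alpha> + \<beta> * \<beta>)"
    and "norm (\<alpha> * \<alpha> - \<beta> * \<beta>) \<le> norm (\<alpha> * \<alpha> + \<beta> * \<beta>)"
proof -
  define u where "u = \<alpha> + \<i> *\<^sub>C \<beta>"
  have su: "star u = \<alpha> - \<i> *\<^sub>C \<beta>"
    by (simp add: u_def star_add star_scaleC sa scaleC_minus_left)
  have ii: "(\<i> *\<^sub>C \<beta>) * (\<i> *\<^sub>C \<beta>) = - (\<beta> * \<beta>)"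
    by (simp add: scaleC_mult_left scaleC_mult_right scaleC_scaleC scaleC_minus_one)
  have ci: "(\<i> *\<^sub>C \<beta>) * \<alpha> = \<alpha> * (\<i> *\<^sub>C \<beta>)"
    by (simp add: scaleC_mult_left scaleC_mult_right comm)
  have "star u * u = \<alpha> * \<alpha> + \<beta> * \<beta>"
    by (simp add: su) (simp add: u_def algebra_simps ii ci)
  then have n: "(norm u)\<^sup>2 = norm (\<alpha> * \<alpha> + \<beta> * \<beta>)"
    by (metis cstar_identity)
  have real_part: "norm x \<le> norm v" if "x = (1/2) *\<^sub>R (v + star v)" for x v :: 'a
    using that norm_triangle_ineq[of v "star v"] by simp
  have "norm \<alpha> \<le> norm u"
    by (rule real_part) (simp add: su, simp add: u_def flip: scaleR_2)
  then show "(norm \<alpha>)\<^sup>2 \<le> norm (\<alpha> * \<alpha> + \<beta> * \<beta>)"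
    by (simp add: power_mono flip: n)
  have "u * u + star u * star u = 2 *\<^sub>R (\<alpha> * \<alpha> - \<beta> * \<beta>)"
    by (simp add: su) (simp add: u_def algebra_simps ii ci scaleR_2)
  then have "norm (\<alpha> * \<alpha> - \<beta> * \<beta>) \<le> norm (u * u)"
    by (intro real_part) (simp add: star_mult)
  also have "\<dots> \<le> (norm u)\<^sup>2"
    by (simp add: norm_mult_ineq power2_eq_square)
  finally show "norm (\<alpha> * \<alpha> - \<beta> * \<beta>) \<le> norm (\<alpha> * \<alpha> + \<beta> * \<beta>)"
    by (simp add: n)
qed

lemma positive_selfadjoint: "cstar_positive h \<Longrightarrow> star h = h"
  by (simp add: cstar_positive_def)

text \<open>Complete \<open>h\<close> to a normal element with the square root of \<open>\<parallel>h\<parallel>\<^sup>2 - h\<^sup>2\<close>.\<close>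

lemma norm_sub_square_le:
  fixes h :: "'a::unital_cstar_algebra"
  assumes sa: "star h = h"
  shows "norm (((norm h)\<^sup>2 / 2) *\<^sub>R 1 - h * h) \<le> (norm h)\<^sup>2 / 2"
proof -
  define \<rho> where "\<rho> = (norm h)\<^sup>2"
  have "cstar_positive (\<rho> *\<^sub>R 1 - h * h)"
    unfolding cstar_positive_def
    by (auto simp: star_diff star_scaleR star_mult sa \<rho>_def norm_square_selfadjoint[OF sa]
        intro!: exI[of _ "\<rho>"])
  then obtain \<beta> where b: "cstar_positive \<beta>" "\<beta> * \<beta> = \<rho> *\<^sub>R 1 - h * h"
    and comm: "\<And>b. b * (\<rho> *\<^sub>R 1 - h * h) = (\<rho> *\<^sub>R 1 - h * h) * b \<Longrightarrow> b * \<beta> = \<beta> * b"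
    using positive_sqrt by metis
  have "h * \<beta> = \<beta> * h"
    by (rule comm) (simp add: algebra_simps)
  from commuting_selfadjoint_norms(2)[OF sa positive_selfadjoint[OF b(1)] this]
  have "norm (h * h + h * h - \<rho> *\<^sub>R 1) \<le> \<rho>"
    by (simp add: b \<rho>_def algebra_simps)
  moreover have "h * h + h * h - \<rho> *\<^sub>R 1 = - (2 *\<^sub>R ((\<rho>/2) *\<^sub>R 1 - h * h))"
    by (simp add: scaleR_diff_right scaleR_2)
  ultimately show ?thesis
    by (simp add: \<rho>_def)
qed

lemma positive_square: "star h = h \<Longrightarrow> cstar_positive (h * h)"
  unfolding cstar_positive_def
  using norm_sub_square_le[of h] by (auto simp: star_mult intro!: exI[of _ "(norm h)\<^sup>2 / 2"])

lemma norm_sub_half_positive_le: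
  assumes "cstar_positive h"
  shows "norm ((norm h / 2) *\<^sub>R 1 - h) \<le> norm h / 2"
proof -
  obtain s where s: "cstar_positive s" "s * s = h"
    using positive_sqrt[OF assms] by metis
  then have "norm h = (norm s)\<^sup>2"
    using norm_square_selfadjoint positive_selfadjoint by metis
  then show ?thesis
    using norm_sub_square_le[OF positive_selfadjoint[OF s(1)]] s(2) by simp
qed

lemma positive_norm_sub:
  assumes "cstar_positive h"
  shows "cstar_positive (norm h *\<^sub>R 1 - h)"
proof -
  have "(norm h / 2) *\<^sub>R 1 - (norm h *\<^sub>R 1 - h) = - ((norm h / 2) *\<^sub>R 1 - h)"
    by (simp add: algebra_simps flip: scaleR_add_left)
  then have "norm ((norm h / 2) *\<^sub>R 1 - (norm h *\<^sub>R 1 - h)) \<le> norm h / 2"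
    using norm_sub_half_positive_le[OF assms] by (metis norm_minus_cancel)
  then show ?thesis
    unfolding cstar_positive_def
    by (intro conjI exI[of _ "norm h / 2"])
      (simp_all add: star_diff star_scaleR positive_selfadjoint[OF assms])
qed

text \<open>The order determines the norm, by the first inequality of
  \<open>commuting_selfadjoint_norms\<close> for the square roots of \<open>q\<close> and \<open>\<rho> - q\<close>.\<close>

lemma norm_le_if_between:
  fixes q :: "'a::unital_cstar_algebra"
  assumes q: "cstar_positive q" and r: "cstar_positive (\<rho> *\<^sub>R 1 - q)"
  shows "norm q \<le> \<rho>"
proof -
  obtain \<alpha> where a: "cstar_positive \<alpha>" "\<alpha> * \<alpha> = q"
    using positive_sqrt[OF q] by metis
  obtain \<beta> where b: "cstar_positive \<beta>" "\<beta> * \<beta> = \<rho> *\<^sub>R 1 - q"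
    and comm: "\<And>b. b * (\<rho> *\<^sub>R 1 - q) = (\<rho> *\<^sub>R 1 - q) * b \<Longrightarrow> b * \<beta> = \<beta> * b"
    using positive_sqrt[OF r] by metis
  have "\<alpha> * \<beta> = \<beta> * \<alpha>"
    by (rule comm) (simp add: a(2)[symmetric] algebra_simps)
  from commuting_selfadjoint_norms(1)[OF positive_selfadjoint[OF a(1)]
      positive_selfadjoint[OF b(1)] this]
  have "(norm \<alpha>)\<^sup>2 \<le> \<bar>\<rho>\<bar>"
    by (simp add: a b)
  moreover have "norm q \<le> (norm \<alpha>)\<^sup>2"
    using norm_mult_ineq[of \<alpha> \<alpha>] by (simp add: a power2_eq_square)
  moreover have "\<rho> \<ge> 0"
  proof -
    have "cstar_positive (\<rho> *\<^sub>R (1::'a))"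
      using positive_add[OF r q] by simp
    then obtain t where "t \<ge> 0" "norm ((t - \<rho>) *\<^sub>R (1::'a)) \<le> t"
      unfolding cstar_positive_def by (auto simp: scaleR_diff_left)
    then show ?thesis by simp
  qed
  ultimately show ?thesis by simp
qed

lemma positive_antisym: "cstar_positive e \<Longrightarrow> cstar_positive (- e) \<Longrightarrow> e = 0"
  using norm_le_if_between[of e 0] by simp

lemma norm_one_add_positive:
  assumes "cstar_positive c"
  shows "norm (1 + c) = 1 + norm c"
proof (rule antisym)
  show "norm (1 + c) \<le> 1 + norm c"
    using norm_triangle_ineq[of 1 c] by simp
  have "cstar_positive ((norm (1 + c) - 1) *\<^sub>R 1 - c)"
    using positive_norm_sub[OF positive_add[OF positive_one assms]] by (simp add: algebra_simps)
  from norm_le_if_between[OF assms this] show "1 + norm c \<le> norm (1 + c)"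
    by simp
qed

section \<open>Elements of the form \<open>star x * x\<close> are positive\<close>

text \<open>If \<open>x > 1\<close> then \<open>x ^ (2 * m) \<ge> (1 + m * (x - 1))\<^sup>2\<close> outgrows \<open>2 * m + 1\<close>.\<close>

lemma le_one_if_powers_le_linear:
  fixes x :: real
  assumes le: "\<And>k. x ^ (2 ^ k) \<le> 2 ^ k + 1"
  shows "x \<le> 1"
proof (rule ccontr)
  assume "\<not> x \<le> 1"
  define d where "d = x - 1"
  have d: "d > 0" using \<open>\<not> x \<le> 1\<close> by (simp add: d_def)
  obtain k where k: "3 / d\<^sup>2 < 2 ^ k"
    using real_arch_pow[of 2 "3 / d\<^sup>2"] by auto
  define m :: real where "m = 2 ^ k"
  have m: "m \<ge> 1" by (simp add: m_def)
  have "1 + m * d \<le> x ^ (2 ^ k)"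
    using Bernoulli_inequality[of d "2 ^ k"] d by (simp add: m_def d_def)
  moreover have "m * d \<le> 1 + m * d"
    by simp
  ultimately have "(m * d)\<^sup>2 \<le> (x ^ (2 ^ k))\<^sup>2"
    using d m by (intro power_mono) auto
  also have "\<dots> = x ^ (2 ^ Suc k)"
    by (simp add: power_mult[symmetric] mult.commute)
  also have "\<dots> \<le> 2 * m + 1"
    using le[of "Suc k"] by (simp add: m_def)
  also have "\<dots> \<le> 3 * m"
    using m by simp
  finally have "m * d\<^sup>2 \<le> 3"
    using m by (simp add: power2_eq_square mult.assoc mult.left_commute)
  moreover have "3 < m * d\<^sup>2"
    using k d by (simp add: m_def field_simps)
  ultimately show False by simp
qed

lemma norm_selfadjoint_power:
  fixes h :: "'a::unital_cstar_algebra"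
  assumes "star h = h"
  shows "norm (h ^ (2 ^ k)) = norm h ^ (2 ^ k)"
proof (induction k)
  case (Suc k)
  have "norm (h ^ (2 ^ Suc k)) = norm (h ^ (2 ^ k) * h ^ (2 ^ k))"
    by (simp add: mult_2 power_add)
  also have "\<dots> = (norm (h ^ (2 ^ k)))\<^sup>2"
    by (rule norm_square_selfadjoint) (simp add: star_power assms)
  also have "\<dots> = norm h ^ (2 ^ Suc k)"
    by (simp add: Suc.IH power_mult[symmetric] mult.commute)
  finally show ?case .
qed simp

text \<open>This says that \<open>y * star y\<close> and \<open>star y * y\<close> cannot have spectra on opposite sides of \<open>0\<close>. With
  \<open>r = \<parallel>y\<parallel>\<^sup>2\<close> let \<open>D = 1 - y * star y / r\<close> and \<open>E = 1 - star y * y / r\<close>. Then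
  \<open>star y * D ^ n * y = E ^ n * (star y * y)\<close> stays bounded since \<open>\<parallel>D\<parallel> \<le> 1\<close>, so the norms of the powers
  of \<open>E\<close> grow at most linearly. As \<open>E\<close> is selfadjoint, \<open>\<parallel>E\<parallel> \<le> 1\<close>, which makes \<open>star y * y\<close> positive
  as well as negative.\<close>

lemma eq_zero_if_opposite_signs:
  fixes y :: "'a::unital_cstar_algebra"
  assumes pos: "cstar_positive (y * star y)" and neg: "cstar_positive (- (star y * y))"
  shows "y = 0"
proof (rule ccontr)
  assume y: "y \<noteq> 0"
  define r where "r = (norm y)\<^sup>2"
  have r: "r > 0" using y by (simp add: r_def)
  define D where "D = 1 - (1/r) *\<^sub>R (y * star y)"
  define E where "E = 1 - (1/r) *\<^sub>R (star y * y)"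
  have "norm (y * star y) = r"
    using cstar_identity[of "star y"] by (simp add: star_star r_def)
  then have "norm ((r/2) *\<^sub>R 1 - y * star y) \<le> r/2"
    using norm_sub_half_positive_le[OF pos] by simp
  moreover have "r *\<^sub>R 1 - y * star y = (r/2) *\<^sub>R 1 + ((r/2) *\<^sub>R 1 - y * star y)"
    by (simp add: algebra_simps flip: scaleR_add_left)
  then have "norm (r *\<^sub>R 1 - y * star y)
      \<le> norm ((r/2) *\<^sub>R (1::'a)) + norm ((r/2) *\<^sub>R 1 - y * star y)"
    by (simp only: norm_triangle_ineq)
  ultimately have "norm (r *\<^sub>R 1 - y * star y) \<le> r"
    using r by simp
  moreover have "D = (1/r) *\<^sub>R (r *\<^sub>R 1 - y * star y)"
    using r by (simp add: D_def scaleR_diff_right)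
  ultimately have "norm D \<le> 1"
    using r by simp
  then have Dn: "norm (D ^ n) \<le> 1" for n
    by (meson norm_ge_zero norm_power_ineq order_trans power_le_one)
  have Dy: "D ^ n * y = y * E ^ n" for n
  proof (induction n)
    case (Suc n)
    have "D * y = y * E"
      by (simp add: D_def E_def algebra_simps)
    then show ?case
      by (metis Suc.IH mult.assoc power_Suc power_Suc2)
  qed simp
  have bound: "norm (star y * y * E ^ n) \<le> r" for n
  proof -
    have "norm (star y * y * E ^ n) = norm (star y * (D ^ n * y))"
      by (simp add: Dy mult.assoc)
    also have "\<dots> \<le> norm y * (norm (D ^ n) * norm y)"
      by (metis (no_types, opaque_lifting) mult_left_mono norm_ge_zero norm_mult_ineq norm_star
          order_trans)
    also have "\<dots> \<le> norm y * (1 * norm y)"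
      using Dn by (intro mult_left_mono mult_right_mono) auto
    finally show ?thesis
      by (simp add: r_def power2_eq_square)
  qed
  have linear: "norm (E ^ n) \<le> real n + 1" for n
  proof (induction n)
    case (Suc n)
    have "E ^ Suc n = E ^ n - (1/r) *\<^sub>R (star y * y * E ^ n)"
      by (simp add: E_def left_diff_distrib)
    then have "norm (E ^ Suc n) \<le> norm (E ^ n) + (1/r) * norm (star y * y * E ^ n)"
      using norm_triangle_ineq4[of "E ^ n" "(1/r) *\<^sub>R (star y * y * E ^ n)"] r by simp
    also have "\<dots> \<le> norm (E ^ n) + (1/r) * r"
      using bound[of n] r by (intro add_left_mono mult_left_mono) auto
    finally show ?case
      using Suc r by simp
  qed simp
  have "star E = E"
    by (simp add: E_def star_diff star_scaleR star_mult star_star)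
  have "norm E ^ (2 ^ k) \<le> 2 ^ k + 1" for k
    using linear[of "2 ^ k"] by (simp add: norm_selfadjoint_power[OF \<open>star E = E\<close>])
  then have "norm E \<le> 1"
    by (rule le_one_if_powers_le_linear)
  moreover have "r *\<^sub>R 1 - star y * y = r *\<^sub>R E"
    using r by (simp add: E_def scaleR_diff_right)
  ultimately have "norm (r *\<^sub>R 1 - star y * y) \<le> r"
    using r by simp
  then have "cstar_positive (star y * y)"
    unfolding cstar_positive_def using r
    by (auto simp: star_mult star_star intro!: exI[of _ r])
  then have "star y * y = 0"
    using positive_antisym neg by blast
  with y show False
    by (simp add: star_mult_self_eq_0)
qed

text \<open>Writing \<open>y = (h - \<i>g) / 2\<close> with selfadjoint \<open>h\<close> and \<open>g\<close> turns the sum into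
  \<open>(h\<^sup>2 + g\<^sup>2) / 2\<close>.\<close>

lemma positive_mult_star_add_star_mult:
  fixes y :: "'a::unital_cstar_algebra"
  shows "cstar_positive (y * star y + star y * y)"
proof -
  define h where "h = y + star y"
  define g where "g = \<i> *\<^sub>C (y - star y)"
  have "star h = h" "star g = g"
    by (simp_all add: h_def g_def star_add star_diff star_star star_scaleC scaleC_minus_left
        scaleC_diff_right add.commute)
  then have "cstar_positive ((1/2) *\<^sub>R (h * h + g * g))"
    by (intro positive_scaleR positive_add positive_square) auto
  moreover have "g * g = - ((y - star y) * (y - star y))"
    by (simp add: g_def scaleC_mult_left scaleC_mult_right scaleC_scaleC scaleC_minus_one)
  then have "h * h + g * g = 2 *\<^sub>R (y * star y + star y * y)"
    by (simp add: h_def algebra_simps scaleR_2)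
  ultimately show ?thesis by simp
qed

text \<open>Kaplansky's theorem. Let \<open>w = \<bar>c\<bar>\<close> be the root of \<open>c\<^sup>2\<close>, and \<open>v = w - c\<close>, twice the negative part
  of \<open>c\<close>. Then \<open>c * v = - w * v\<close>, so \<open>y = x * v\<close> has \<open>star y * y = - w * v\<^sup>2\<close>, which is negative, while
  \<open>y * star y\<close> is positive as a sum of positive elements. Hence \<open>y\<close> vanishes, and with it \<open>v\<close>.\<close>

lemma positive_star_mult:
  fixes x :: "'a::unital_cstar_algebra"
  shows "cstar_positive (star x * x)"
proof -
  define c where "c = star x * x"
  have sc: "star c = c"
    by (simp add: c_def star_mult star_star)
  obtain w where w: "cstar_positive w" "w * w = c * c"
    and wcomm: "\<And>b. b * (c * c) = (c * c) * b \<Longrightarrow> b * w = w * b"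
    using positive_sqrt[OF positive_square[OF sc]] by metis
  obtain s where s: "cstar_positive s" "s * s = w" and scomm: "\<And>b. b * w = w * b \<Longrightarrow> b * s = s * b"
    using positive_sqrt[OF w(1)] by metis
  define v where "v = w - c"
  have cw: "c * w = w * c"
    by (rule wcomm) (simp add: mult.assoc)
  have sv: "star v = v"
    by (simp add: v_def star_diff sc positive_selfadjoint[OF w(1)])
  have wv: "v * w = w * v"
    by (simp add: v_def algebra_simps cw)
  have vs: "v * s = s * v"
    by (rule scomm[OF wv])
  have cv: "c * v = - (w * v)"
    by (simp add: v_def algebra_simps cw w(2))
  define y where "y = x * v"
  have yy: "star y * y = - (w * v * v)"
  proof -
    have "star y * y = v * (c * v)"
      by (simp add: y_def c_def star_mult sv mult.assoc)
    then show ?thesis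
      by (simp add: cv wv flip: mult.assoc)
  qed
  have "(s * v) * (s * v) = w * v * v"
    by (metis mult.assoc s(2) vs)
  moreover have "star (s * v) = s * v"
    by (simp add: star_mult sv positive_selfadjoint[OF s(1)] vs)
  ultimately have pw: "cstar_positive (w * v * v)"
    using positive_square by metis
  have "y * star y = (y * star y + star y * y) + w * v * v"
    by (simp add: yy)
  then have "cstar_positive (y * star y)"
    using positive_add[OF positive_mult_star_add_star_mult pw] by metis
  then have "y = 0"
    using eq_zero_if_opposite_signs pw yy by (metis minus_minus)
  then have wvv: "w * v * v = 0"
    using yy by simp
  have "v * v * v = w * v * v - c * v * v"
    by (simp add: v_def left_diff_distrib)
  also have "\<dots> = 0"
    by (simp add: cv wvv)
  finally have "v * v * v = 0" .
  then have "star (v * v) * (v * v) = 0"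
    by (simp add: star_mult sv mult.assoc[symmetric])
  then have "v * v = 0"
    by (simp only: star_mult_self_eq_0)
  then have "v = 0"
    using star_mult_self_eq_0[of v] sv by simp
  then have "c = w"
    by (simp add: v_def)
  with w(1) show ?thesis
    by (simp add: c_def)
qed

section \<open>Linear functionals below a sublinear one\<close>

definition sublinear :: "('v::real_vector \<Rightarrow> real) \<Rightarrow> bool"
  where "sublinear p \<longleftrightarrow> (\<forall>x y. p (x + y) \<le> p x + p y) \<and> (\<forall>t>0. \<forall>x. p (t *\<^sub>R x) = t * p x)"

lemma sublinear_zero: "sublinear p \<Longrightarrow> p 0 = 0"
  unfolding sublinear_def by (metis scaleR_zero_right mult_cancel_right1 zero_less_numeral
      numeral_eq_one_iff semiring_norm(85))

lemma sublinear_lower: "sublinear p \<Longrightarrow> - p (- x) \<le> p x"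
  using sublinear_zero[of p] unfolding sublinear_def
  by (metis add.right_inverse add.commute neg_le_iff_le minus_le_iff diff_0 diff_le_eq)

lemma sublinear_scaleR_nonneg: "sublinear p \<Longrightarrow> t \<ge> 0 \<Longrightarrow> p (t *\<^sub>R x) = t * p x"
  by (cases "t = 0") (auto simp: sublinear_zero sublinear_def)

text \<open>The homogeneity inequality at \<open>1/t\<close> is the reverse of the one at \<open>t\<close>.\<close>

lemma sublinearI:
  assumes add: "\<And>x y. p (x + y) \<le> p x + p y"
    and scale: "\<And>t x. t > 0 \<Longrightarrow> p (t *\<^sub>R x) \<le> t * p x"
  shows "sublinear p"
  unfolding sublinear_def
proof (intro conjI allI impI add)
  fix t :: real and x
  assume t: "t > 0"
  have "p ((1/t) *\<^sub>R (t *\<^sub>R x)) \<le> (1/t) * p (t *\<^sub>R x)"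
    using t by (intro scale) simp
  then have "t * p x \<le> p (t *\<^sub>R x)"
    using t by (simp add: field_simps)
  with scale[OF t, of x] show "p (t *\<^sub>R x) = t * p x" by simp
qed

text \<open>The largest sublinear functional below \<open>p\<close> that is linear on the line through \<open>y\<close> and agrees
  with \<open>p\<close> at \<open>y\<close>.\<close>

definition linearize_at :: "'v::real_vector \<Rightarrow> ('v \<Rightarrow> real) \<Rightarrow> 'v \<Rightarrow> real"
  where "linearize_at y p x = (INF t\<in>{0..}. p (x + t *\<^sub>R y) - t * p y)"

context
  fixes p :: "'v::real_vector \<Rightarrow> real" and y :: 'v
  assumes p: "sublinear p"
begin

lemma linearize_at_lower: "- p (- x) \<le> p (x + t *\<^sub>R y) - t * p y" if "t \<ge> 0"
proof -
  have "p (t *\<^sub>R y) \<le> p (x + t *\<^sub>R y) + p (- x)"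
    using p unfolding sublinear_def by (metis add.commute add_uminus_conv_diff add_diff_cancel_left')
  then show ?thesis
    by (simp add: sublinear_scaleR_nonneg[OF p that])
qed

lemma linearize_at_le: "linearize_at y p x \<le> p (x + t *\<^sub>R y) - t * p y" if "t \<ge> 0"
  unfolding linearize_at_def
  by (rule cINF_lower) (use that linearize_at_lower in \<open>auto intro!: bdd_belowI2\<close>)

lemma linearize_at_greatest:
  "(\<And>t. t \<ge> 0 \<Longrightarrow> m \<le> p (x + t *\<^sub>R y) - t * p y) \<Longrightarrow> m \<le> linearize_at y p x"
  unfolding linearize_at_def by (rule cINF_greatest) auto

lemma linearize_at_le_self: "linearize_at y p x \<le> p x"
  using linearize_at_le[of 0 x] by simp

lemma sublinear_linearize_at: "sublinear (linearize_at y p)"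
proof (rule sublinearI)
  fix x z
  have *: "linearize_at y p (x + z) \<le> (p (x + t *\<^sub>R y) - t * p y) + (p (z + s *\<^sub>R y) - s * p y)"
    if "t \<ge> 0" "s \<ge> 0" for s t
  proof -
    have "linearize_at y p (x + z) \<le> p (x + z + (t + s) *\<^sub>R y) - (t + s) * p y"
      using that by (intro linearize_at_le) simp
    moreover have "x + z + (t + s) *\<^sub>R y = (x + t *\<^sub>R y) + (z + s *\<^sub>R y)"
      by (simp add: scaleR_add_left)
    then have "p (x + z + (t + s) *\<^sub>R y) \<le> p (x + t *\<^sub>R y) + p (z + s *\<^sub>R y)"
      using p unfolding sublinear_def by metis
    ultimately show ?thesis
      by (simp add: distrib_right)
  qed
  have "linearize_at y p (x + z) - (p (z + s *\<^sub>R y) - s * p y) \<le> linearize_at y p x"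
    if "s \<ge> 0" for s
    by (rule linearize_at_greatest) (use *[OF _ that] in \<open>simp add: algebra_simps\<close>)
  then have "linearize_at y p (x + z) - linearize_at y p x \<le> linearize_at y p z"
    by (intro linearize_at_greatest) (simp add: algebra_simps)
  then show "linearize_at y p (x + z) \<le> linearize_at y p x + linearize_at y p z"
    by simp
next
  fix r :: real and x
  assume r: "r > 0"
  have "linearize_at y p (r *\<^sub>R x) / r \<le> linearize_at y p x"
  proof (rule linearize_at_greatest)
    fix t :: real assume t: "t \<ge> 0"
    have "linearize_at y p (r *\<^sub>R x) \<le> p (r *\<^sub>R x + (r * t) *\<^sub>R y) - (r * t) * p y"
      using r t by (intro linearize_at_le) simp
    also have "r *\<^sub>R x + (r * t) *\<^sub>R y = r *\<^sub>R (x + t *\<^sub>R y)"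
      by (simp add: scaleR_add_right)
    also have "p \<dots> = r * p (x + t *\<^sub>R y)"
      using r by (intro sublinear_scaleR_nonneg[OF p]) simp
    finally show "linearize_at y p (r *\<^sub>R x) / r \<le> p (x + t *\<^sub>R y) - t * p y"
      using r by (simp add: field_simps)
  qed
  then show "linearize_at y p (r *\<^sub>R x) \<le> r * linearize_at y p x"
    using r by (simp add: field_simps)
qed

end

lemma linear_if_minimal_sublinear:
  fixes p :: "'v::real_vector \<Rightarrow> real"
  assumes p: "sublinear p" and min: "\<And>q. sublinear q \<Longrightarrow> q \<le> p \<Longrightarrow> q = p"
  shows "linear p"
proof -
  have add: "p (x + y) = p x + p y" for x y
  proof (rule antisym)
    show "p (x + y) \<le> p x + p y"
      using p by (simp add: sublinear_def)
    have "linearize_at y p = p"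
      by (intro min sublinear_linearize_at[OF p] le_funI linearize_at_le_self[OF p])
    with linearize_at_le[OF p, of 1 y x] show "p x + p y \<le> p (x + y)"
      by simp
  qed
  have neg: "p (- x) = - p x" for x
    using add[of x "- x"] sublinear_zero[OF p] by simp
  have "p (r *\<^sub>R x) = r * p x" for r x
  proof (cases "r \<ge> 0")
    case False
    then have "p ((- r) *\<^sub>R x) = (- r) * p x"
      by (intro sublinear_scaleR_nonneg[OF p]) simp
    then show ?thesis
      by (simp add: neg)
  qed (rule sublinear_scaleR_nonneg[OF p])
  then show ?thesis
    by (intro linearI) (simp_all add: add)
qed

text \<open>A minimal element exists by Zorn: along a chain the pointwise infimum is again sublinear, the
  values being bounded below by \<open>- p (- x)\<close>.\<close>

lemma minimal_sublinear_exists: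
  fixes p :: "'v::real_vector \<Rightarrow> real"
  assumes p: "sublinear p"
  obtains m where "sublinear m" "m \<le> p" "\<And>q. sublinear q \<Longrightarrow> q \<le> m \<Longrightarrow> q = m"
proof -
  define A where "A = {q. sublinear q \<and> q \<le> p}"
  have "\<exists>m\<in>A. \<forall>q\<in>A. q \<le> m \<longrightarrow> q = m"
  proof (rule predicate_Zorn)
    show "partial_order_on A (relation_of (\<lambda>q q'. q' \<le> q) A)"
      by (rule partial_order_on_relation_ofI) auto
    fix C assume C: "C \<in> Chains (relation_of (\<lambda>q q'. q' \<le> q) A)"
    have total: "f \<le> g \<or> g \<le> f" if "f \<in> C" "g \<in> C" for f g
      using C that by (auto simp: Chains_def relation_of_def)
    have CA: "C \<subseteq> A"
      using C by (auto simp: Chains_def relation_of_def)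
    show "\<exists>u\<in>A. \<forall>a\<in>C. u \<le> a"
    proof (cases "C = {}")
      case True
      then show ?thesis using p by (auto simp: A_def)
    next
      case False
      define u where "u x = (INF q\<in>C. q x)" for x
      have lower: "- p (- x) \<le> q x" if "q \<in> C" for q x
      proof -
        have "sublinear q" "q (- x) \<le> p (- x)"
          using that CA by (auto simp: A_def le_fun_def)
        with sublinear_lower[of q x] show ?thesis by simp
      qed
      have u_le: "u x \<le> q x" if "q \<in> C" for q x
        unfolding u_def by (rule cINF_lower) (use that lower in \<open>auto intro!: bdd_belowI2\<close>)
      have le_u: "m \<le> u x" if "\<And>q. q \<in> C \<Longrightarrow> m \<le> q x" for m x
        unfolding u_def using False that by (rule cINF_greatest)
      have "sublinear u"
      proof (rule sublinearI)
        fix x z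
        have *: "u (x + z) \<le> f x + g z" if fg: "f \<in> C" "g \<in> C" for f g
        proof -
          obtain h where h: "h \<in> C" "h \<le> f" "h \<le> g"
            using total[OF fg] fg by blast
          have "u (x + z) \<le> h (x + z)"
            by (rule u_le[OF h(1)])
          also have "\<dots> \<le> h x + h z"
            using h(1) CA by (auto simp: A_def sublinear_def)
          also have "\<dots> \<le> f x + g z"
            using h by (intro add_mono) (auto simp: le_fun_def)
          finally show ?thesis .
        qed
        have "u (x + z) - g z \<le> u x" if "g \<in> C" for g
          by (rule le_u) (use *[OF _ that] in \<open>simp add: algebra_simps\<close>)
        then have "u (x + z) - u x \<le> u z"
          by (intro le_u) (simp add: algebra_simps)
        then show "u (x + z) \<le> u x + u z" by simp
      next
        fix t :: real and x
        assume t: "t > 0"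
        have "u (t *\<^sub>R x) / t \<le> u x"
        proof (rule le_u)
          fix q assume q: "q \<in> C"
          then have "q (t *\<^sub>R x) = t * q x"
            using CA t by (auto simp: A_def sublinear_def)
          with u_le[OF q, of "t *\<^sub>R x"] show "u (t *\<^sub>R x) / t \<le> q x"
            using t by (simp add: field_simps)
        qed
        then show "u (t *\<^sub>R x) \<le> t * u x"
          using t by (simp add: field_simps)
      qed
      moreover obtain q where "q \<in> C" "q \<le> p"
        using False CA by (auto simp: A_def)
      then have "u \<le> p"
        using u_le by (meson le_funI order_trans le_funD)
      ultimately have "u \<in> A"
        by (simp add: A_def)
      moreover have "\<forall>a\<in>C. u \<le> a"
        using u_le by (simp add: le_fun_def)
      ultimately show ?thesis by blast
    qed
  qed
  then show thesis
    using that unfolding A_def by (metis (no_types, lifting) mem_Collect_eq order_trans)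
qed

text \<open>The Hahn--Banach theorem. Linearizing at \<open>y\<close> first forces \<open>f (- y) \<le> - p y\<close>, so that the
  minimal functional attains the value of \<open>p\<close> at \<open>y\<close>.\<close>

lemma hahn_banach_supporting_functional:
  fixes p :: "'v::real_vector \<Rightarrow> real"
  assumes p: "sublinear p"
  obtains f where "linear f" "\<And>x. f x \<le> p x" "f y = p y"
proof -
  obtain f where f: "sublinear f" "f \<le> linearize_at y p" "\<And>q. sublinear q \<Longrightarrow> q \<le> f \<Longrightarrow> q = f"
    using minimal_sublinear_exists[OF sublinear_linearize_at[OF p]] by metis
  have lin: "linear f"
    using f(1,3) by (rule linear_if_minimal_sublinear)
  have le: "f x \<le> p x" for x
    using f(2) linearize_at_le_self[OF p] by (meson le_funD order_trans)
  have "f (- y) \<le> linearize_at y p (- y)"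
    using f(2) by (simp add: le_fun_def)
  also have "\<dots> \<le> - p y"
    using linearize_at_le[OF p, of 1 y "- y"] sublinear_zero[OF p] by simp
  finally have "p y \<le> f y"
    by (simp add: linear_neg[OF lin])
  with le[of y] have "f y = p y" by simp
  with lin le show thesis by (rule that)
qed

section \<open>States\<close>

lemma functional_scaleR:
  assumes "\<And>c x. \<phi> (c *\<^sub>C x) = c * \<phi> (x::'a::complex_normed_vector)"
  shows "\<phi> (r *\<^sub>R x) = of_real r * \<phi> x"
  using assms[of "of_real r" x] by (simp add: scaleC_of_real)

lemma star_mult_add_scalar:
  fixes x :: "'a::unital_cstar_algebra"
  shows "star (x + c *\<^sub>C 1) * (x + c *\<^sub>C 1)
    = star x * x + c *\<^sub>C star x + cnj c *\<^sub>C x + (cnj c * c) *\<^sub>C 1"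
  by (simp add: star_add star_scaleC algebra_simps scaleC_mult_left scaleC_mult_right
      scaleC_scaleC scaleC_add_right)

text \<open>The values at \<open>star (x + c) * (x + c)\<close> are real. Comparing \<open>c = 1\<close> with \<open>c = \<i>\<close> shows that
  the functional is hermitian.\<close>

lemma positive_functional_star:
  fixes \<phi> :: "'a::unital_cstar_algebra \<Rightarrow> complex"
  assumes add: "\<And>x y. \<phi> (x + y) = \<phi> x + \<phi> y" and scale: "\<And>c x. \<phi> (c *\<^sub>C x) = c * \<phi> x"
    and pos: "\<And>x. \<phi> (star x * x) \<in> \<real>\<^sub>\<ge>\<^sub>0"
  shows "\<phi> (star x) = cnj (\<phi> x)"
proof -
  have Im0: "Im (\<phi> (star z * z)) = 0" for z
    using pos[of z] by (simp add: complex_nonneg_Reals_iff)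
  have "Im (\<phi> 1) = 0"
    using Im0[of 1] by simp
  then have "Im (c * \<phi> (star x) + cnj c * \<phi> x) = 0" for c
    using Im0[of "x + c *\<^sub>C 1"] Im0[of x]
    by (simp add: star_mult_add_scalar add scale complex_mult_cnj mult.commute[of "cnj c" c])
  from this[of 1] this[of \<i>] show ?thesis
    by (simp add: complex_eq_iff)
qed

lemma positive_functional_quadratic:
  fixes \<phi> :: "'a::unital_cstar_algebra \<Rightarrow> complex"
  assumes add: "\<And>x y. \<phi> (x + y) = \<phi> x + \<phi> y" and scale: "\<And>c x. \<phi> (c *\<^sub>C x) = c * \<phi> x"
    and pos: "\<And>x. \<phi> (star x * x) \<in> \<real>\<^sub>\<ge>\<^sub>0"
  shows "Re (\<phi> (star (x + c *\<^sub>C 1) * (x + c *\<^sub>C 1)))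
    = Re (\<phi> (star x * x)) + 2 * (c \<bullet> \<phi> x) + (cmod c)\<^sup>2 * Re (\<phi> 1)"
proof -
  have "cnj c * c = of_real ((cmod c)\<^sup>2)"
    by (metis complex_norm_square mult.commute of_real_power)
  then show ?thesis
    by (simp add: star_mult_add_scalar add scale positive_functional_star[OF add scale pos]
        inner_complex_def)
qed

text \<open>A positive functional of norm 1 takes the value \<open>p = 1\<close> at the unit: positivity at
  \<open>x - \<phi> x\<close> gives \<open>(2 - p) * \<bar>\<phi> x\<bar>\<^sup>2 \<le> \<phi> (star x * x) \<le> \<parallel>x\<parallel>\<^sup>2\<close>, so that the norm is at most
  \<open>1 / sqrt (2 - p)\<close>.\<close>

lemma state_one:
  assumes "\<phi> \<in> states"
  shows "\<phi> 1 = 1"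
proof -
  have bl: "bounded_linear \<phi>" and scale: "\<And>c x. \<phi> (c *\<^sub>C x) = c * \<phi> x"
    and pos: "\<And>x. \<phi> (star x * x) \<in> \<real>\<^sub>\<ge>\<^sub>0" and on: "onorm \<phi> = 1"
    using assms by (auto simp: states_def)
  have add: "\<phi> (x + y) = \<phi> x + \<phi> y" for x y
    by (rule bounded_linear.linear[OF bl, THEN linear_add])
  have le: "cmod (\<phi> x) \<le> norm x" for x
    using onorm[OF bl, of x] on by simp
  define p where "p = Re (\<phi> 1)"
  have "\<phi> 1 \<in> \<real>\<^sub>\<ge>\<^sub>0"
    using pos[of 1] by simp
  then have p1: "\<phi> 1 = of_real p"
    by (simp add: p_def complex_nonneg_Reals_iff complex_eq_iff)
  have "p \<le> 1"
    using le[of 1] p1 by simp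
  have "cmod (\<phi> x) \<le> (1 / sqrt (2 - p)) * norm x" for x
  proof -
    have "0 \<le> Re (\<phi> (star (x + (- \<phi> x) *\<^sub>C 1) * (x + (- \<phi> x) *\<^sub>C 1)))"
      using pos by (simp add: complex_nonneg_Reals_iff)
    also have "\<dots> = Re (\<phi> (star x * x)) - (2 - p) * (cmod (\<phi> x))\<^sup>2"
      by (subst positive_functional_quadratic[OF add scale pos])
        (simp_all add: p_def dot_square_norm algebra_simps)
    finally have "(2 - p) * (cmod (\<phi> x))\<^sup>2 \<le> Re (\<phi> (star x * x))" by simp
    also have "\<dots> \<le> (norm x)\<^sup>2"
      using le[of "star x * x"] complex_Re_le_cmod[of "\<phi> (star x * x)"]
      by (simp add: cstar_identity)
    finally have "sqrt ((2 - p) * (cmod (\<phi> x))\<^sup>2) \<le> sqrt ((norm x)\<^sup>2)"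
      by (rule real_sqrt_le_mono)
    then have "sqrt (2 - p) * cmod (\<phi> x) \<le> norm x"
      by (simp only: real_sqrt_mult real_sqrt_abs abs_norm_cancel)
    then show ?thesis
      using \<open>p \<le> 1\<close> by (simp add: field_simps)
  qed
  then have "onorm \<phi> \<le> 1 / sqrt (2 - p)"
    using \<open>p \<le> 1\<close> by (intro onorm_bound) auto
  then have "sqrt (2 - p) \<le> 1"
    using on \<open>p \<le> 1\<close> by (simp add: field_simps)
  then have "p = 1"
    using \<open>p \<le> 1\<close> by simp
  with p1 show ?thesis by simp
qed

text \<open>Unlike the norm condition, all conditions here are preserved by convex combinations and
  pointwise limits.\<close>

lemma states_iff:
  fixes \<phi> :: "'a::unital_cstar_algebra \<Rightarrow> complex"
  shows "\<phi> \<in> states \<longleftrightarrow> (\<forall>x y. \<phi> (x + y) = \<phi> x + \<phi> y) \<and> (\<forall>c x. \<phi> (c *\<^sub>C x) = c * \<phi> x) \<and>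
    (\<forall>x. \<phi> (star x * x) \<in> \<real>\<^sub>\<ge>\<^sub>0) \<and> (\<forall>x. cmod (\<phi> x) \<le> norm x) \<and> \<phi> 1 = 1"
    (is "?L \<longleftrightarrow> ?R")
proof
  assume L: ?L
  then have bl: "bounded_linear \<phi>" and on: "onorm \<phi> = 1"
    by (auto simp: states_def)
  have "\<phi> (x + y) = \<phi> x + \<phi> y" for x y
    by (rule bounded_linear.linear[OF bl, THEN linear_add])
  moreover have "cmod (\<phi> x) \<le> norm x" for x
    using onorm[OF bl, of x] on by simp
  ultimately show ?R
    using L state_one[OF L] by (auto simp: states_def)
next
  assume R: ?R
  then have scale: "\<And>c x. \<phi> (c *\<^sub>C x) = c * \<phi> x" by blast
  have bl: "bounded_linear \<phi>"
    by (rule bounded_linear_intro[where K = 1])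
      (use R in \<open>simp_all add: functional_scaleR[OF scale] scaleR_conv_of_real[where 'a = complex]\<close>)
  have "onorm \<phi> \<le> 1"
    by (rule onorm_bound) (use R in auto)
  moreover have "1 \<le> onorm \<phi>"
    using onorm[OF bl, of 1] R by simp
  ultimately show ?L
    using R bl by (auto simp: states_def)
qed

lemma state_bounds:
  assumes "\<phi> \<in> states"
  shows "0 \<le> Re (\<phi> (star b * b))" "Re (\<phi> (star b * b)) \<le> (norm b)\<^sup>2"
proof -
  from assms have "\<phi> (star b * b) \<in> \<real>\<^sub>\<ge>\<^sub>0" "cmod (\<phi> (star b * b)) \<le> norm (star b * b)"
    by (auto simp: states_iff)
  then show "0 \<le> Re (\<phi> (star b * b))" "Re (\<phi> (star b * b)) \<le> (norm b)\<^sup>2"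
    using complex_Re_le_cmod[of "\<phi> (star b * b)"]
    by (auto simp: complex_nonneg_Reals_iff cstar_identity)
qed

lemma state_shift:
  assumes "\<phi> \<in> states"
  shows "Re (\<phi> (star (b + c *\<^sub>C 1) * (b + c *\<^sub>C 1)))
    = Re (\<phi> (star b * b)) + 2 * (c \<bullet> \<phi> b) + (cmod c)\<^sup>2"
  using assms unfolding states_iff by (subst positive_functional_quadratic) auto

text \<open>The functional supporting the norm at \<open>1 + star x * x\<close>, whose norm is \<open>1 + \<parallel>x\<parallel>\<^sup>2\<close>, must attain
  the norms of \<open>1\<close> and of \<open>star x * x\<close>. A real functional of norm 1 attaining it at \<open>1\<close> is nonnegative
  on the positive cone, as each positive element lies in a ball with centre \<open>t\<close> and radius \<open>t\<close>.
  It is extended to a complex functional through real and imaginary parts.\<close>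

lemma state_attaining_norm:
  fixes x :: "'a::unital_cstar_algebra"
  obtains \<phi> where "\<phi> \<in> states" "Re (\<phi> (star x * x)) = (norm x)\<^sup>2"
proof -
  define c where "c = star x * x"
  have nc: "norm c = (norm x)\<^sup>2"
    by (simp add: c_def cstar_identity)
  have "sublinear (norm :: 'a \<Rightarrow> real)"
    by (rule sublinearI) (simp_all add: norm_triangle_ineq)
  then obtain f :: "'a \<Rightarrow> real" where lin: "linear f" and le: "\<And>z. f z \<le> norm z"
    and f1c: "f (1 + c) = norm (1 + c)"
    using hahn_banach_supporting_functional[where y = "1 + c"] by metis
  have "f 1 + f c = 1 + norm c"
    using f1c norm_one_add_positive[OF positive_star_mult[of x]]
    by (simp add: linear_add[OF lin] c_def)
  then have f1: "f 1 = 1" and fc: "f c = norm c"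
    using le[of 1] le[of c] by simp_all
  have fpos: "f q \<ge> 0" if "cstar_positive q" for q
  proof -
    obtain t where "norm (t *\<^sub>R 1 - q) \<le> t"
      using \<open>cstar_positive q\<close> by (auto simp: cstar_positive_def)
    with le[of "t *\<^sub>R 1 - q"] show ?thesis
      by (simp add: linear_diff[OF lin] linear_scale[OF lin] f1)
  qed
  define re where "re z = (1/2) *\<^sub>R (z + star z)" for z :: 'a
  define \<phi> where "\<phi> z = Complex (f (re z)) (- f (re (\<i> *\<^sub>C z)))" for z
  have re_add: "re (z + w) = re z + re w" for z w
    by (simp add: re_def star_add scaleR_add_right)
  have re_scaleR: "re (r *\<^sub>R z) = r *\<^sub>R re z" for r z
    by (simp add: re_def star_scaleR scaleR_add_right)
  have re_sa: "re z = z" "re (\<i> *\<^sub>C z) = 0" if "star z = z" for z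
    using that by (simp_all add: re_def star_scaleC scaleC_minus_left flip: scaleR_2)
  have add: "\<phi> (z + w) = \<phi> z + \<phi> w" for z w
    by (simp add: \<phi>_def complex_eq_iff re_add scaleC_add_right linear_add[OF lin])
  have scale: "\<phi> (k *\<^sub>C z) = k * \<phi> z" for k z
  proof -
    have "k = of_real (Re k) + of_real (Im k) * \<i>"
      by (simp add: complex_eq_iff)
    then have "k *\<^sub>C z = Re k *\<^sub>R z + Im k *\<^sub>R (\<i> *\<^sub>C z)"
      by (metis scaleC_add_left scaleC_of_real scaleC_scaleC)
    then have "\<phi> (k *\<^sub>C z) = \<phi> (Re k *\<^sub>R z) + \<phi> (Im k *\<^sub>R (\<i> *\<^sub>C z))"
      by (simp add: add)
    moreover have real: "\<phi> (r *\<^sub>R w) = of_real r * \<phi> w" for r w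
    proof -
      have "\<i> *\<^sub>C (r *\<^sub>R w) = r *\<^sub>R (\<i> *\<^sub>C w)"
        by (simp add: scaleR_eq_scaleC scaleC_scaleC mult.commute)
      then show ?thesis
        by (simp add: \<phi>_def complex_eq_iff re_scaleR linear_scale[OF lin])
    qed
    moreover have "\<phi> (\<i> *\<^sub>C z) = \<i> * \<phi> z"
    proof -
      have "re (\<i> *\<^sub>C (\<i> *\<^sub>C z)) = - re z"
        by (simp add: scaleC_scaleC scaleC_minus_one re_def star_minus flip: scaleR_minus_right)
      then show ?thesis
        by (simp add: \<phi>_def complex_eq_iff linear_neg[OF lin])
    qed
    ultimately show ?thesis
      by (simp add: complex_eq_iff)
  qed
  have pos: "\<phi> (star z * z) = of_real (f (star z * z))" "f (star z * z) \<ge> 0" for z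
    using fpos[OF positive_star_mult[of z]]
    by (simp_all add: \<phi>_def complex_eq_iff re_sa star_mult star_star linear_0[OF lin])
  have bound: "cmod (\<phi> z) \<le> norm z" for z
  proof -
    \<comment> \<open>Rotate \<open>z\<close> until the value becomes real.\<close>
    obtain k where k: "cmod k = 1" "k * \<phi> z = of_real (cmod (\<phi> z))"
    proof (cases "\<phi> z = 0")
      case True
      then show thesis by (intro that[of 1]) auto
    next
      case False
      have "cnj (\<phi> z) * \<phi> z = of_real (cmod (\<phi> z)) * of_real (cmod (\<phi> z))"
        by (metis complex_norm_square mult.commute of_real_power power2_eq_square)
      with False show thesis
        by (intro that[of "cnj (\<phi> z) / of_real (cmod (\<phi> z))"]) (simp_all add: norm_divide)
    qed
    have "cmod (\<phi> z) = Re (\<phi> (k *\<^sub>C z))"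
      by (simp add: scale k)
    also have "\<dots> = f (re (k *\<^sub>C z))"
      by (simp add: \<phi>_def)
    also have "\<dots> \<le> norm (re (k *\<^sub>C z))"
      by (rule le)
    also have "\<dots> \<le> norm (k *\<^sub>C z)"
      using norm_triangle_ineq[of "k *\<^sub>C z" "star (k *\<^sub>C z)"] by (simp add: re_def)
    finally show ?thesis
      by (simp add: norm_scaleC k)
  qed
  have "\<phi> 1 = 1"
    using pos(1)[of 1] by (simp add: f1)
  with add scale pos bound have "\<phi> \<in> states"
    by (auto simp: states_iff complex_nonneg_Reals_iff)
  moreover have "Re (\<phi> (star x * x)) = (norm x)\<^sup>2"
    using pos(1)[of x] fc nc by (simp add: c_def)
  ultimately show thesis by (rule that)
qed

text \<open>Banach--Alaoglu: the states form a closed subset of a product of discs.\<close>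

lemma compact_states: "compact (states :: ('a::unital_cstar_algebra \<Rightarrow> complex) set)"
proof -
  define B where "B = (\<Pi>\<^sub>E x\<in>(UNIV::'a set). cball (0::complex) (norm x))"
  have "compactin (product_topology (\<lambda>_. euclidean) UNIV) B"
    unfolding B_def by (simp add: compactin_PiE)
  then have "compact B"
    by (simp add: euclidean_product_topology)
  have eval: "continuous_on UNIV (\<lambda>\<phi>. \<phi> x)" for x :: 'a
    by (rule continuous_on_product_coordinates)
  define C :: "('a \<Rightarrow> complex) set" where
    "C = (\<Inter>x y. {\<phi>. \<phi> (x + y) = \<phi> x + \<phi> y}) \<inter> (\<Inter>c x. {\<phi>. \<phi> (c *\<^sub>C x) = c * \<phi> x})
       \<inter> (\<Inter>x. {\<phi>. \<phi> (star x * x) \<in> \<real>\<^sub>\<ge>\<^sub>0}) \<inter> {\<phi>. \<phi> 1 = 1}"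
  have "closed {\<phi> :: 'a \<Rightarrow> complex. \<phi> (star x * x) \<in> \<real>\<^sub>\<ge>\<^sub>0}" for x
    using closed_vimage[OF closed_nonneg_Reals_complex eval] by (simp add: vimage_def)
  then have "closed C"
    unfolding C_def
    by (intro closed_Int closed_INT ballI closed_Collect_eq continuous_intros eval)
  have "(states :: ('a \<Rightarrow> complex) set) = B \<inter> C"
    by (auto simp: states_iff B_def C_def PiE_UNIV_domain Pi_iff)
  then show ?thesis
    using compact_Int_closed[OF \<open>compact B\<close> \<open>closed C\<close>] by metis
qed

lemma convex_combination_states:
  assumes "\<phi> \<in> states" "\<psi> \<in> states" "u \<ge> 0" "v \<ge> 0" "u + v = 1"
  shows "(\<lambda>x. of_real u * \<phi> x + of_real v * \<psi> x) \<in> states"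
proof -
  have "cmod (of_real u * \<phi> x + of_real v * \<psi> x) \<le> norm x" for x
  proof -
    have "cmod (of_real u * \<phi> x + of_real v * \<psi> x) \<le> u * cmod (\<phi> x) + v * cmod (\<psi> x)"
      using norm_triangle_ineq[of "of_real u * \<phi> x" "of_real v * \<psi> x"] assms
      by (simp add: norm_mult)
    also have "\<dots> \<le> u * norm x + v * norm x"
      using assms by (intro add_mono mult_left_mono) (auto simp: states_iff)
    also have "\<dots> = norm x"
      using assms(5) by (simp flip: distrib_right)
    finally show ?thesis .
  qed
  moreover have "of_real u + of_real v = (1::complex)"
    using assms(5) by (metis of_real_1 of_real_add)
  ultimately show ?thesis
    using assms unfolding states_iff
    by (auto simp: algebra_simps complex_nonneg_Reals_iff)
qed

section \<open>The Davis--Wielandt shell and its upper boundary\<close>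

lemma compact_DV: "compact (DV b)"
proof -
  have "continuous_on states (\<lambda>\<phi>. (\<phi> b, Re (\<phi> (star b * b))))"
    by (intro continuous_intros continuous_on_subset[OF continuous_on_product_coordinates]) auto
  moreover have "DV b = (\<lambda>\<phi>. (\<phi> b, Re (\<phi> (star b * b)))) ` states"
    by (auto simp: DV_def)
  ultimately show ?thesis
    using compact_continuous_image[OF _ compact_states] by metis
qed

lemma convex_DV: "convex (DV b)"
proof (rule convexI)
  fix z w and u v :: real
  assume "z \<in> DV b" "w \<in> DV b" and uv: "u \<ge> 0" "v \<ge> 0" "u + v = 1"
  then obtain \<phi> \<psi> where "\<phi> \<in> states" "\<psi> \<in> states" and
    zw: "z = (\<phi> b, Re (\<phi> (star b * b)))" "w = (\<psi> b, Re (\<psi> (star b * b)))"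
    by (auto simp: DV_def)
  with uv have "(\<lambda>x. of_real u * \<phi> x + of_real v * \<psi> x) \<in> states"
    by (intro convex_combination_states)
  then show "u *\<^sub>R z + v *\<^sub>R w \<in> DV b"
    unfolding DV_def
    by (intro CollectI exI[of _ "\<lambda>x. of_real u * \<phi> x + of_real v * \<psi> x"])
      (simp add: zw scaleR_conv_of_real)
qed

text \<open>The function \<open>c \<mapsto> \<parallel>b + c\<parallel>\<^sup>2 - \<bar>c\<bar>\<^sup>2\<close> is the support function of the shell in the
  directions \<open>(2 * c, 1)\<close>, which point upwards.\<close>

lemma DV_le_norm_shift:
  assumes "(\<mu>, r) \<in> DV b"
  shows "r + 2 * (c \<bullet> \<mu>) \<le> (norm (b + c *\<^sub>C 1))\<^sup>2 - (cmod c)\<^sup>2"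
proof -
  obtain \<phi> where \<phi>: "\<phi> \<in> states" "\<mu> = \<phi> b" "r = Re (\<phi> (star b * b))"
    using assms by (auto simp: DV_def)
  then show ?thesis
    using state_bounds(2)[OF \<phi>(1), of "b + c *\<^sub>C 1"] state_shift[OF \<phi>(1), of b c] by simp
qed

lemma DV_attains_norm_shift:
  obtains \<mu> r where "(\<mu>, r) \<in> DV b" "r + 2 * (c \<bullet> \<mu>) = (norm (b + c *\<^sub>C 1))\<^sup>2 - (cmod c)\<^sup>2"
proof -
  obtain \<phi> where \<phi>: "\<phi> \<in> states"
    "Re (\<phi> (star (b + c *\<^sub>C 1) * (b + c *\<^sub>C 1))) = (norm (b + c *\<^sub>C 1))\<^sup>2"
    using state_attaining_norm by blast
  then show thesis
    using state_shift[OF \<phi>(1), of b c]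
    by (intro that[of "\<phi> b" "Re (\<phi> (star b * b))"]) (auto simp: DV_def)
qed

text \<open>Only upward directions are controlled by the norms, so the point \<open>(\<mu>, r)\<close> is separated from
  \<open>DV b\<close> together with the whole ray above it. The separating hyperplane can be vertical. Boundedness of
  \<open>DV b\<close> allows it to be tilted a little, after which some \<open>(2 * c, 1)\<close> is normal to it.\<close>

lemma DV_dominated_if_norm_le:
  fixes a b :: "'a::unital_cstar_algebra"
  assumes le: "\<And>c. norm (a + c *\<^sub>C 1) \<le> norm (b + c *\<^sub>C 1)" and a: "(\<mu>, r) \<in> DV a"
  shows "\<exists>s\<ge>r. (\<mu>, s) \<in> DV b"
proof (rule ccontr)
  assume none: "\<not> ?thesis"
  have "DV b \<noteq> {}"
    using DV_attains_norm_shift[of b 0] by auto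
  moreover have "({\<mu>} \<times> {r..}) \<inter> DV b = {}"
    using none by auto
  moreover have "convex ({\<mu>} \<times> {r..})" "closed ({\<mu>} \<times> {r..})"
    by (simp_all add: convex_Times closed_Times)
  ultimately obtain n \<beta> where n: "\<forall>z\<in>{\<mu>} \<times> {r..}. n \<bullet> z < \<beta>" "\<forall>z\<in>DV b. n \<bullet> z > \<beta>"
    using separating_hyperplane_closed_compact convex_DV compact_DV by metis
  obtain v d where nd: "n = (v, d)"
    by (cases n)
  have ray: "v \<bullet> \<mu> + d * t < \<beta>" if "t \<ge> r" for t
    using n(1) that by (auto simp: nd)
  have shell: "v \<bullet> \<nu> + d * s > \<beta>" if "(\<nu>, s) \<in> DV b" for \<nu> s
    using n(2) that by (auto simp: nd)
  have "d \<le> 0"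
  proof (rule ccontr)
    assume d: "\<not> d \<le> 0"
    define t where "t = max r ((\<beta> - v \<bullet> \<mu>) / d)"
    have "\<beta> - v \<bullet> \<mu> \<le> d * t"
      using d by (simp add: t_def field_simps max_def)
    moreover have "t \<ge> r" by (simp add: t_def)
    ultimately show False
      using ray[of t] by simp
  qed
  define gap where "gap = \<beta> - (v \<bullet> \<mu> + d * r)"
  have gap: "gap > 0"
    using ray[of r] by (simp add: gap_def)
  \<comment> \<open>On the shell of \<open>b\<close> the second coordinate is at most \<open>\<parallel>b\<parallel>\<^sup>2\<close>, so this tilt costs less than the
    gap.\<close>
  define \<epsilon> where "\<epsilon> = gap / ((norm b)\<^sup>2 + 1)"
  have \<epsilon>: "\<epsilon> > 0" "\<epsilon> * (norm b)\<^sup>2 < gap"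
    using gap by (simp_all add: \<epsilon>_def field_simps add_pos_nonneg)
  define e where "e = \<epsilon> - d"
  have e: "e > 0"
    using \<epsilon> \<open>d \<le> 0\<close> by (simp add: e_def)
  have "r \<ge> 0"
    using a state_bounds(1) by (auto simp: DV_def)
  have tilted: "e * s - v \<bullet> \<nu> < e * r - v \<bullet> \<mu>" if "(\<nu>, s) \<in> DV b" for \<nu> s
  proof -
    have "s \<le> (norm b)\<^sup>2"
      using that state_bounds(2) by (auto simp: DV_def)
    then have "\<epsilon> * s < gap"
      using \<epsilon> by (meson less_eq_real_def mult_left_mono order_le_less_trans)
    moreover have "\<epsilon> * r \<ge> 0"
      using \<epsilon> \<open>r \<ge> 0\<close> by simp
    ultimately show ?thesis
      using shell[OF that] by (simp add: e_def gap_def algebra_simps)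
  qed
  define c where "c = (- 1 / (2 * e)) *\<^sub>R v"
  have c: "s + 2 * (c \<bullet> \<nu>) = (e * s - v \<bullet> \<nu>) / e" for s \<nu>
    using e by (simp add: c_def field_simps)
  obtain \<nu> s where \<nu>s: "(\<nu>, s) \<in> DV b"
    "s + 2 * (c \<bullet> \<nu>) = (norm (b + c *\<^sub>C 1))\<^sup>2 - (cmod c)\<^sup>2"
    using DV_attains_norm_shift by blast
  have "s + 2 * (c \<bullet> \<nu>) < r + 2 * (c \<bullet> \<mu>)"
    unfolding c using tilted[OF \<nu>s(1)] e by (simp add: divide_strict_right_mono)
  also have "\<dots> \<le> (norm (a + c *\<^sub>C 1))\<^sup>2 - (cmod c)\<^sup>2"
    by (rule DV_le_norm_shift[OF a])
  also have "\<dots> \<le> (norm (b + c *\<^sub>C 1))\<^sup>2 - (cmod c)\<^sup>2"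
    using le by (simp add: power_mono)
  finally show False
    using \<nu>s(2) by simp
qed

lemma norm_le_if_DV_dominated:
  fixes a b :: "'a::unital_cstar_algebra"
  assumes dom: "\<And>\<mu> r. (\<mu>, r) \<in> DV a \<Longrightarrow> \<exists>s\<ge>r. (\<mu>, s) \<in> DV b"
  shows "norm (a + c *\<^sub>C 1) \<le> norm (b + c *\<^sub>C 1)"
proof -
  obtain \<mu> r where r: "(\<mu>, r) \<in> DV a" "r + 2 * (c \<bullet> \<mu>) = (norm (a + c *\<^sub>C 1))\<^sup>2 - (cmod c)\<^sup>2"
    using DV_attains_norm_shift by blast
  obtain s where "s \<ge> r" "(\<mu>, s) \<in> DV b"
    using dom[OF r(1)] by blast
  with DV_le_norm_shift[of \<mu> s b c] r(2)
  have "(norm (a + c *\<^sub>C 1))\<^sup>2 \<le> (norm (b + c *\<^sub>C 1))\<^sup>2"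
    by linarith
  then show ?thesis
    by (rule power2_le_imp_le) simp
qed

lemma DV_fibre_iff: "s \<in> DV_fibre \<mu> b \<longleftrightarrow> (\<mu>, s) \<in> DV b"
  by (auto simp: DV_fibre_def DV_def)

lemma DV_ub_iff: "(\<mu>, r) \<in> DV_ub b \<longleftrightarrow> (\<mu>, r) \<in> DV b \<and> (\<forall>s. (\<mu>, s) \<in> DV b \<longrightarrow> s \<le> r)"
  by (auto simp: DV_ub_def DV_fibre_iff)

text \<open>By compactness every point of the shell lies below one of the upper boundary.\<close>

lemma DV_below_DV_ub:
  assumes "(\<mu>, r) \<in> DV b"
  obtains s where "s \<ge> r" "(\<mu>, s) \<in> DV_ub b"
proof -
  have "compact (DV b \<inter> ({\<mu>} \<times> UNIV))"
    by (intro compact_Int_closed compact_DV closed_Times) auto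
  then have "compact (snd ` (DV b \<inter> ({\<mu>} \<times> UNIV)))"
    by (intro compact_continuous_image continuous_intros)
  moreover have "snd ` (DV b \<inter> ({\<mu>} \<times> UNIV)) = {s. (\<mu>, s) \<in> DV b}"
    by force
  ultimately obtain s where "(\<mu>, s) \<in> DV b" "\<forall>t\<in>{s. (\<mu>, s) \<in> DV b}. t \<le> s"
    using compact_attains_sup[of "{s. (\<mu>, s) \<in> DV b}"] assms by auto
  with assms show thesis
    by (intro that[of s]) (auto simp: DV_ub_iff)
qed

lemma DV_ub_eq_iff_mutually_dominated:
  fixes a b :: "'a::unital_cstar_algebra"
  shows "DV_ub a = DV_ub b \<longleftrightarrow>
    (\<forall>\<mu> r. (\<mu>, r) \<in> DV a \<longrightarrow> (\<exists>s\<ge>r. (\<mu>, s) \<in> DV b)) \<and>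
    (\<forall>\<mu> r. (\<mu>, r) \<in> DV b \<longrightarrow> (\<exists>s\<ge>r. (\<mu>, s) \<in> DV a))"
    (is "?L \<longleftrightarrow> ?R")
proof
  assume L: ?L
  have "\<exists>s\<ge>r. (\<mu>, s) \<in> DV y" if r: "(\<mu>, r) \<in> DV x" and eq: "DV_ub x = DV_ub y"
    for x y :: 'a and \<mu> r
  proof -
    obtain s where "s \<ge> r" "(\<mu>, s) \<in> DV_ub x"
      using DV_below_DV_ub[OF r] by blast
    then show ?thesis
      using eq DV_ub_iff[of \<mu> s y] by auto
  qed
  with L show ?R by metis
next
  assume R: ?R
  have "(\<mu>, r) \<in> DV_ub y"
    if r: "(\<mu>, r) \<in> DV_ub x"
      and xy: "\<And>\<mu> r. (\<mu>, r) \<in> DV x \<Longrightarrow> \<exists>s\<ge>r. (\<mu>, s) \<in> DV y"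
      and yx: "\<And>\<mu> r. (\<mu>, r) \<in> DV y \<Longrightarrow> \<exists>s\<ge>r. (\<mu>, s) \<in> DV x"
    for x y :: 'a and \<mu> r
  proof -
    have le: "t \<le> r" if t: "(\<mu>, t) \<in> DV y" for t
    proof -
      obtain s where "s \<ge> t" "(\<mu>, s) \<in> DV x"
        using yx[OF t] by blast
      with r show "t \<le> r"
        unfolding DV_ub_iff by fastforce
    qed
    obtain s where s: "s \<ge> r" "(\<mu>, s) \<in> DV y"
      using xy r unfolding DV_ub_iff by blast
    with le[OF s(2)] have "s = r" by simp
    with s le show ?thesis
      unfolding DV_ub_iff by blast
  qed
  then have "(\<mu>, r) \<in> DV_ub a \<longleftrightarrow> (\<mu>, r) \<in> DV_ub b" for \<mu> r
    using R by (meson order_refl)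
  then show ?L
    by (simp add: set_eq_iff split_paired_all)
qed

lemma DV_ub_eq_iff_norm_shift_eq:
  fixes a b :: "'a::unital_cstar_algebra"
  shows "DV_ub a = DV_ub b \<longleftrightarrow> (\<forall>c. norm (a + c *\<^sub>C 1) = norm (b + c *\<^sub>C 1))"
proof
  assume "DV_ub a = DV_ub b"
  then show "\<forall>c. norm (a + c *\<^sub>C 1) = norm (b + c *\<^sub>C 1)"
    unfolding DV_ub_eq_iff_mutually_dominated
    by (intro allI antisym norm_le_if_DV_dominated) auto
next
  assume "\<forall>c. norm (a + c *\<^sub>C 1) = norm (b + c *\<^sub>C 1)"
  then show "DV_ub a = DV_ub b"
    unfolding DV_ub_eq_iff_mutually_dominated
    by (intro conjI allI impI DV_dominated_if_norm_le) auto
qed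

theorem theorem2p4:
  fixes a :: "'a::unital_cstar_algebra"
  shows "a \<bottom>\<^sub>R 1 \<longleftrightarrow> DV_ub a = DV_ub (- a)"
proof -
  have "norm (- a + c *\<^sub>C 1) = norm (a - c *\<^sub>C 1)" for c
    by (metis norm_minus_commute uminus_add_conv_diff)
  then show ?thesis
    unfolding roberts_orthogonal_def DV_ub_eq_iff_norm_shift_eq by simp
qed

end
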